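(* Let $S$ be a nonempty, closed, and convex subset of a generalized Banach algebra $X$ satisfying the sequential condition $(\mathcal{GP})$. Assume that $A,C:X\to X$ and $B:S\to X$ are three weakly sequentially continuous operators satisfying the following conditions: (i) $A$ and $C$ are contractive with Lipschitz matrices $M_A$ and $M_C$ respectively; (ii) $A$ is regular on $X$, i.e. $A$ maps $X$ into the set of all invertible elements of $X$; (iii) $B(S)$ is bounded; (iv) if $y\in S$ and $x=Ax\cdot By+Cx$, then $x\in S$; (v) $\left(\frac{I-C}{A}\right)^{-1}$ is weakly compact. If $\|B(S)\|M_A+M_C\in\mathcal{M}_{n\times n}(\mathbb{R}_+)$ is a matrix converging to zero, then the operator equation $x=Ax\cdot Bx+Cx$ has at least one solution $x\in S$.
   Context: $\mathbb{R}^n$ is ordered componentwise. A generalized Banach space (in the sense of Perov) is a real vector space $X$ with a vector-valued norm $\|\cdot\|=(\|\cdot\|_1,\dots,\|\cdot\|_n):X\to\mathbb{R}^n_+$ ($\|x\|=0$ iff $x=0$, $\|\lambda x\|=|\lambda|\|x\|$, $\|x+y\|\le\|x\|+\|y\|$ componentwise), complete for the topology given by $\max_i\|x\|_i$. A generalized Banach algebra is a generalized Banach space that is an algebra with $\|x\cdot y\|_i\le\|x\|_i\|y\|_i$ for all $i$ and all $x,y$; it has a unit whenever invertible elements are mentioned. The weak topology of $X$ is the coarsest topology making all continuous linear functionals continuous; $\rightharpoonup$ is weak convergence. $X$ satisfies $(\mathcal{GP})$ if $x_k\rightharpoonup x$ and $y_k\rightharpoonup y$ imply $x_k\cdot y_k\rightharpoonup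 x\cdot y$. A map $T$ is weakly sequentially continuous if $x_k\rightharpoonup x$ (in its domain) implies $Tx_k\rightharpoonup Tx$; it is weakly compact if it maps bounded subsets of its domain to relatively weakly compact sets. A square nonnegative matrix converges to zero if its spectral radius is $<1$. $T$ is contractive with Lipschitz matrix $M\in\mathcal{M}_{n\times n}(\mathbb{R}_+)$ if $M$ converges to zero and $\|Tx-Ty\|\le M\|x-y\|$ for all $x,y$. For $A$ regular, $\frac{I-C}{A}$ is the operator sending $x$ to the unique element $z$ with $Ax\cdot z=x-Cx$, and $\left(\frac{I-C}{A}\right)^{-1}$ is its inverse. With $M_A=(a_{ij})$, $M_C=(\overline a_{ij})$ and $\|B(S)\|=(b_j)_{1\le j\le n}$, $b_j=\sup_{y\in S}\|By\|_j$, the matrix $\|B(S)\|M_A+M_C$ is the one with $(i,j)$ entry $b_ja_{ij}+\overline a_{ij}$.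
   Formalization: In (v) it is additionally assumed that the inverse of (I-C)/A, taken as a partial operator defined where exactly one preimage exists, is defined on B(S); with the matrix entries b_j a_ij + c_ij this does not follow from the matrix condition, and without it the claim can fail. *)

theory Defs
  imports "HOL-Analysis.Analysis" "Jordan_Normal_Form.Spectral_Radius"
begin

unbundle no vec_syntax

text \<open>
  Vectors of length \<open>n\<close> and \<open>n\<close> by \<open>n\<close> matrices are those of \<open>Jordan_Normal_Form\<close> (indices
  \<open>0, \<dots>, n - 1\<close>); its order \<open>\<le>\<close> on vectors is the componentwise one.

  The topology of a generalized Banach space is that of the norm \<open>max\<^sub>i \<parallel>x\<parallel>\<^sub>i\<close>.  The locale
  assumption \<open>norm_eq_Max\<close> identifies the norm of the type class with this maximum, so the class
  \<open>banach\<close> expresses completeness for it.  The scalar inequality \<open>norm (x * y) \<le> norm x * norm y\<close>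
  of the class \<open>real_normed_algebra\<close> is no restriction, as it follows from \<open>vn_mult\<close>.
\<close>

locale generalized_banach_algebra =
  fixes n :: nat
    and vn :: "'a::{real_normed_algebra, banach} \<Rightarrow> real Matrix.vec"
  assumes dim_pos: "0 < n"
    and vn_carrier: "vn x \<in> carrier_vec n"
    and vn_nonneg: "0\<^sub>v n \<le> vn x"
    and vn_eq_0_iff: "vn x = 0\<^sub>v n \<longleftrightarrow> x = 0"
    and vn_scaleR: "vn (c *\<^sub>R x) = \<bar>c\<bar> \<cdot>\<^sub>v vn x"
    and vn_triangle: "vn (x + y) \<le> vn x + vn y"
    and vn_mult: "i < n \<Longrightarrow> vn (x * y) $ i \<le> vn x $ i * vn y $ i"
    and norm_eq_Max: "norm x = Max ((\<lambda>i. vn x $ i) ` {..<n})"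

text \<open>
  The unit is an explicit argument because \<open>ring_1\<close> would exclude the zero algebra and
  \<open>real_normed_algebra_1\<close> would in addition impose \<open>norm 1 = 1\<close>.
\<close>

definition is_unit_element :: "'a::ring \<Rightarrow> bool" where
  "is_unit_element e \<longleftrightarrow> (\<forall>x. e * x = x \<and> x * e = x)"

definition invertible_elements :: "'a::ring \<Rightarrow> 'a set" where
  "invertible_elements e = {x. \<exists>y. x * y = e \<and> y * x = e}"

definition regular_operator :: "'a::ring \<Rightarrow> ('a \<Rightarrow> 'a) \<Rightarrow> bool" where
  "regular_operator e A \<longleftrightarrow> range A \<subseteq> invertible_elements e"

definition weak_topology :: "'a::real_normed_vector topology" where
  "weak_topology = topology_generated_by
     {f -` U | (f :: 'a \<Rightarrow> real) U. linear f \<and> continuous_on UNIV f \<and> open U}"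

definition weakly_converges :: "(nat \<Rightarrow> 'a::real_normed_vector) \<Rightarrow> 'a \<Rightarrow> bool" where
  "weakly_converges u x \<longleftrightarrow> limitin weak_topology u x sequentially"

definition relatively_weakly_compact :: "'a::real_normed_vector set \<Rightarrow> bool" where
  "relatively_weakly_compact K \<longleftrightarrow> compactin weak_topology (weak_topology closure_of K)"

definition condition_GP :: "'a::real_normed_algebra itself \<Rightarrow> bool" where
  "condition_GP _ \<longleftrightarrow>
     (\<forall>(u :: nat \<Rightarrow> 'a) v x y. weakly_converges u x \<longrightarrow> weakly_converges v y \<longrightarrow>
        weakly_converges (\<lambda>k. u k * v k) (x * y))"

definition weakly_seq_continuous_on ::
    "'a::real_normed_vector set \<Rightarrow> ('a \<Rightarrow> 'a) \<Rightarrow> bool" where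
  "weakly_seq_continuous_on D T \<longleftrightarrow>
     (\<forall>u x. (\<forall>k. u k \<in> D) \<longrightarrow> x \<in> D \<longrightarrow> weakly_converges u x \<longrightarrow>
        weakly_converges (\<lambda>k. T (u k)) (T x))"

definition weakly_compact_on ::
    "'a::real_normed_vector set \<Rightarrow> ('a \<Rightarrow> 'a) \<Rightarrow> bool" where
  "weakly_compact_on D T \<longleftrightarrow>
     (\<forall>E. E \<subseteq> D \<longrightarrow> bounded E \<longrightarrow> relatively_weakly_compact (T ` E))"

definition nonneg_matrix :: "nat \<Rightarrow> real mat \<Rightarrow> bool" where
  "nonneg_matrix n M \<longleftrightarrow> M \<in> carrier_mat n n \<and> (\<forall>i<n. \<forall>j<n. 0 \<le> M $$ (i, j))"

definition converges_to_zero :: "real mat \<Rightarrow> bool" where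
  "converges_to_zero M \<longleftrightarrow> spectral_radius (map_mat complex_of_real M) < 1"

definition contractive_with ::
    "nat \<Rightarrow> ('a::real_normed_vector \<Rightarrow> real Matrix.vec) \<Rightarrow> real mat \<Rightarrow> ('a \<Rightarrow> 'a) \<Rightarrow> bool" where
  "contractive_with n vn M T \<longleftrightarrow> nonneg_matrix n M \<and> converges_to_zero M \<and>
     (\<forall>x y. vn (T x - T y) \<le> M *\<^sub>v vn (x - y))"

definition sup_vnorm :: "nat \<Rightarrow> ('a \<Rightarrow> real Matrix.vec) \<Rightarrow> 'a set \<Rightarrow> real Matrix.vec" where
  "sup_vnorm n vn E = Matrix.vec n (\<lambda>j. SUP z\<in>E. vn z $ j)"

text \<open>\<open>b M + N\<close>: the vector \<open>b\<close> scales the columns of \<open>M\<close>.\<close>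

definition scale_add_matrix ::
    "nat \<Rightarrow> real Matrix.vec \<Rightarrow> real mat \<Rightarrow> real mat \<Rightarrow> real mat" where
  "scale_add_matrix n b M N =
     Matrix.mat n n (\<lambda>(i, j). b $ j * M $$ (i, j) + N $$ (i, j))"

text \<open>The operator \<open>(I - C) / A\<close>; the description is proper when \<open>A\<close> is regular.\<close>

definition quotient_operator :: "('a::ring \<Rightarrow> 'a) \<Rightarrow> ('a \<Rightarrow> 'a) \<Rightarrow> 'a \<Rightarrow> 'a" where
  "quotient_operator A C x = (THE z. A x * z = x - C x)"

text \<open>
  \<open>(I - C) / A\<close> need not be injective on the whole space, so its inverse is a partial operator:
  it is defined at \<open>z\<close> if exactly one \<open>x\<close> is mapped to \<open>z\<close>.  For injective \<open>Q\<close> the domain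
  below is \<open>range Q\<close>, for bijective \<open>Q\<close> it is \<open>UNIV\<close>.
\<close>

definition inverse_domain :: "('a \<Rightarrow> 'b) \<Rightarrow> 'b set" where
  "inverse_domain Q = {z. \<exists>!x. Q x = z}"

definition inverse_operator :: "('a \<Rightarrow> 'b) \<Rightarrow> 'b \<Rightarrow> 'a" where
  "inverse_operator Q z = (THE x. Q x = z)"

end

theory Submission
  imports Defs
begin

text \<open>
  For \<open>y \<in> S\<close> let \<open>T y\<close> be the unique \<open>x\<close> with \<open>x = A x * B y + C x\<close>, the value of the inverse of
  \<open>(I - C) / A\<close> at \<open>B y\<close>.  Then \<open>T\<close> maps \<open>S\<close> into \<open>S\<close>, its image is relatively weakly compact, and
  extracting weakly convergent subsequences of \<open>T (u k)\<close> together with \<open>(GP)\<close> shows that \<open>T\<close> is weakly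
  sequentially continuous.  A fixed point of \<open>T\<close> is a solution.

  Such a \<open>T\<close> has a fixed point (Arino, Gautier and Penot).  Shrinking \<open>S\<close> to the closure of a countable
  set, countably many functionals embed the weak closure \<open>W\<close> of the image into the metric space
  \<open>nat \<Rightarrow> real\<close>.  Every functional is uniformly continuous on the compact metric space obtained, so
  Schauder projections and Brouwer's theorem give points \<open>x k\<close> with \<open>x k - T (x k)\<close> weakly null.
  Since \<open>T (x k)\<close> has a weak limit point in \<open>W\<close>, so has \<open>x k\<close>, and this limit is fixed.  In this way
  weak compactness of the closed convex hull of \<open>W\<close> (the Krein-Smulian theorem) is never needed.
\<close>

section \<open>Separation by continuous functionals\<close>

text \<open>Negative values are allowed and homogeneity is required only for
  \<open>c \<ge> 0\<close>, so that norms and linear functionals are both covered.\<close>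

definition sublinear :: "('a::real_vector \<Rightarrow> real) \<Rightarrow> bool" where
  "sublinear q \<longleftrightarrow>
     (\<forall>x y. q (x + y) \<le> q x + q y) \<and> (\<forall>c\<ge>0. \<forall>x. q (c *\<^sub>R x) = c * q x)"

lemma sublinearI:
  assumes add: "\<And>x y. q (x + y) \<le> q x + q y"
    and scale: "\<And>c x. 0 \<le> c \<Longrightarrow> q (c *\<^sub>R x) \<le> c * q x"
  shows "sublinear q"
  unfolding sublinear_def
proof (intro conjI allI impI add)
  fix c :: real and x
  assume c: "0 \<le> c"
  have "c * q x \<le> q (c *\<^sub>R x)"
  proof (cases "c = 0")
    case True
    then show ?thesis using add[of 0 0] by simp
  next
    case False
    with scale[of "1 / c" "c *\<^sub>R x"] c show ?thesis by (simp add: field_simps)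
  qed
  with scale[OF c, of x] show "q (c *\<^sub>R x) = c * q x" by simp
qed

lemma sublinear_add: "sublinear q \<Longrightarrow> q (x + y) \<le> q x + q y"
  and sublinear_scale: "sublinear q \<Longrightarrow> 0 \<le> c \<Longrightarrow> q (c *\<^sub>R x) = c * q x"
  by (auto simp: sublinear_def)

lemma sublinear_zero: "sublinear q \<Longrightarrow> q 0 = 0"
  using sublinear_scale[of q 0 0] by simp

lemma sublinear_ge_uminus: "sublinear q \<Longrightarrow> - q (- x) \<le> q x"
  using sublinear_add[of q x "- x"] sublinear_zero[of q] by simp

text \<open>By oddness, subadditivity at \<open>- x\<close> and \<open>- y\<close> is
  superadditivity at \<open>x\<close> and \<open>y\<close>; oddness also carries homogeneity over to
  negative scalars.\<close>

lemma sublinear_odd_imp_linear: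
  assumes q: "sublinear q" and odd: "\<And>x. q (- x) = - q x"
  shows "linear q"
proof (rule linearI)
  fix x y
  have "q (- x + - y) \<le> q (- x) + q (- y)" by (rule sublinear_add[OF q])
  moreover have "q (- x + - y) = - q (x + y)"
    using odd[of "x + y"] by simp
  ultimately show "q (x + y) = q x + q y"
    using sublinear_add[OF q, of x y] by (simp add: odd)
next
  fix c x
  show "q (c *\<^sub>R x) = c *\<^sub>R q x"
  proof (cases "0 \<le> c")
    case True
    then show ?thesis by (simp add: sublinear_scale[OF q])
  next
    case False
    then have "q (c *\<^sub>R x) = - q ((- c) *\<^sub>R x)" by (simp add: odd)
    with False show ?thesis by (simp add: sublinear_scale[OF q] del: scaleR_minus_left)
  qed
qed

text \<open>
  The infimum of \<open>q (x + t s) - t d\<close> over \<open>t \<ge> 0\<close> and \<open>s \<in> S\<close> serves twice: with \<open>S\<close> a singleton it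
  shows that minimal sublinear functionals are odd, hence linear; with \<open>q\<close> the norm and \<open>d\<close> the
  distance from \<open>0\<close> to \<open>S\<close> it yields separation.
\<close>

lemma sublinear_lower:
  fixes q :: "'a::real_vector \<Rightarrow> real"
  assumes q: "sublinear q" and S: "convex S" "S \<noteq> {}" and d: "\<And>s. s \<in> S \<Longrightarrow> d \<le> q s"
  obtains q' where "sublinear q'" "\<And>x. q' x \<le> q x" "\<And>s. s \<in> S \<Longrightarrow> q' (- s) \<le> - d"
proof -
  define Z where "Z x = {q (x + t *\<^sub>R s) - t * d | t s. 0 \<le> t \<and> s \<in> S}" for x
  define q' where "q' x = Inf (Z x)" for x
  \<comment> \<open>Subadditivity and \<open>t * d \<le> q (t *\<^sub>R s)\<close> bound
    \<open>Z x\<close> from below, so the infimum \<open>q' x\<close> is a genuine one.\<close>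
  have lower: "- q (- x) \<le> z" if "z \<in> Z x" for x z
  proof -
    obtain t s where z: "z = q (x + t *\<^sub>R s) - t * d" and t: "0 \<le> t" and s: "s \<in> S"
      using \<open>z \<in> Z x\<close> unfolding Z_def by auto
    have "t * d \<le> q (t *\<^sub>R s)"
      using d[OF s] t by (simp add: sublinear_scale[OF q] mult_left_mono)
    also have "\<dots> \<le> q (x + t *\<^sub>R s) + q (- x)"
      using sublinear_add[OF q, of "x + t *\<^sub>R s" "- x"] by simp
    finally show ?thesis by (simp add: z)
  qed
  have bdd: "bdd_below (Z x)" for x
    using lower by (rule bdd_belowI)
  have ne: "Z x \<noteq> {}" for x
  proof -
    obtain s where "s \<in> S" using S(2) by blast
    then have "q (x + 0 *\<^sub>R s) - 0 * d \<in> Z x" unfolding Z_def by blast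
    then show ?thesis by blast
  qed
  have le: "q' x \<le> z" if "z \<in> Z x" for x z
    unfolding q'_def by (rule cInf_lower[OF that bdd])
  have add: "q' (x + y) \<le> z + z'" if z: "z \<in> Z x" and z': "z' \<in> Z y" for x y z z'
  proof -
    obtain t s where z: "z = q (x + t *\<^sub>R s) - t * d" and t: "0 \<le> t" and s: "s \<in> S"
      using z unfolding Z_def by auto
    obtain t' s' where z': "z' = q (y + t' *\<^sub>R s') - t' * d" and t': "0 \<le> t'" and s': "s' \<in> S"
      using z' unfolding Z_def by auto
    \<comment> \<open>This is where convexity enters: for \<open>t + t' > 0\<close> the point
      \<open>r\<close> is the average of \<open>s\<close> and \<open>s'\<close> with weights
      proportional to \<open>t\<close> and \<open>t'\<close>.\<close>
    have "\<exists>r\<in>S. t *\<^sub>R s + t' *\<^sub>R s' = (t + t') *\<^sub>R r"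
    proof (cases "t + t' = 0")
      case True
      with t t' have "t = 0" "t' = 0" by auto
      with s show ?thesis by auto
    next
      case False
      with t t' have pos: "0 < t + t'" by auto
      have "(t / (t + t')) *\<^sub>R s + (t' / (t + t')) *\<^sub>R s' \<in> S"
        using S(1) s s' t t' pos
        by (intro convexD) (auto simp: add_divide_distrib[symmetric])
      moreover have "(t + t') *\<^sub>R ((t / (t + t')) *\<^sub>R s + (t' / (t + t')) *\<^sub>R s') = t *\<^sub>R s + t' *\<^sub>R s'"
        using pos by (simp add: scaleR_add_right)
      ultimately show ?thesis by metis
    qed
    then obtain r where r: "r \<in> S" "t *\<^sub>R s + t' *\<^sub>R s' = (t + t') *\<^sub>R r" by blast
    have sum: "(x + t *\<^sub>R s) + (y + t' *\<^sub>R s') = (x + y) + (t + t') *\<^sub>R r"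
      unfolding r(2)[symmetric] by (simp only: add_ac)
    have "q ((x + y) + (t + t') *\<^sub>R r) - (t + t') * d \<in> Z (x + y)"
      using r(1) add_nonneg_nonneg[OF t t'] unfolding Z_def by blast
    then have "q' (x + y) \<le> q ((x + t *\<^sub>R s) + (y + t' *\<^sub>R s')) - (t + t') * d"
      unfolding sum by (rule le)
    also have "\<dots> \<le> z + z'"
      using sublinear_add[OF q, of "x + t *\<^sub>R s" "y + t' *\<^sub>R s'"]
      by (simp add: z z' algebra_simps)
    finally show ?thesis .
  qed
  have scale: "c * z \<in> Z (c *\<^sub>R x)" if "0 \<le> c" "z \<in> Z x" for c x z
  proof -
    obtain t s where z: "z = q (x + t *\<^sub>R s) - t * d" and t: "0 \<le> t" and s: "s \<in> S"
      using \<open>z \<in> Z x\<close> unfolding Z_def by auto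
    have "c * z = q (c *\<^sub>R x + (c * t) *\<^sub>R s) - (c * t) * d"
      using sublinear_scale[OF q \<open>0 \<le> c\<close>, of "x + t *\<^sub>R s"]
      by (simp add: z algebra_simps)
    then show ?thesis unfolding Z_def using s mult_nonneg_nonneg[OF \<open>0 \<le> c\<close> t] by blast
  qed
  show ?thesis
  proof
    show "sublinear q'"
    proof (rule sublinearI)
      fix x y
      have "q' (x + y) - z \<le> z'" if "z \<in> Z x" "z' \<in> Z y" for z z'
        using add[OF that] by simp
      then have "q' (x + y) - z \<le> q' y" if "z \<in> Z x" for z
        unfolding q'_def[of y] using that by (intro cInf_greatest ne)
      then have "q' (x + y) - q' y \<le> z" if "z \<in> Z x" for z
        using that by (simp add: le_diff_eq diff_le_eq add.commute)
      then have "q' (x + y) - q' y \<le> q' x"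
        unfolding q'_def[of x] by (intro cInf_greatest ne)
      then show "q' (x + y) \<le> q' x + q' y" by simp
    next
      fix c :: real and x
      assume c: "0 \<le> c"
      show "q' (c *\<^sub>R x) \<le> c * q' x"
      proof (cases "c = 0")
        case True
        obtain z where "z \<in> Z x" using ne by blast
        with le[OF scale[OF c this]] True show ?thesis by simp
      next
        case False
        with c have "0 < c" by simp
        have "q' (c *\<^sub>R x) / c \<le> q' x"
          unfolding q'_def[of x] using ne le[OF scale[OF c]] \<open>0 < c\<close>
          by (intro cInf_greatest) (auto simp: field_simps)
        with \<open>0 < c\<close> show ?thesis by (simp add: field_simps)
      qed
    qed
    show "q' x \<le> q x" for x
    proof (rule le)
      obtain s where "s \<in> S" using S(2) by blast
      then have "q (x + 0 *\<^sub>R s) - 0 * d \<in> Z x" unfolding Z_def by blast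
      then show "q x \<in> Z x" by simp
    qed
    \<comment> \<open>The choice \<open>t = 1\<close> with the same \<open>s\<close> leaves
      \<open>q 0 - d\<close>.\<close>
    show "q' (- s) \<le> - d" if "s \<in> S" for s
    proof (rule le)
      have "q (- s + 1 *\<^sub>R s) - 1 * d \<in> Z (- s)"
        unfolding Z_def using that by (intro CollectI exI[of _ 1] exI[of _ s]) simp
      then show "- d \<in> Z (- s)" using sublinear_zero[OF q] by simp
    qed
  qed
qed

text \<open>A form of the Hahn-Banach theorem. Zorn's lemma yields a minimal sublinear functional
  below \<open>p\<close>; lowering it along a single point cannot change it, which forces oddness
  and hence linearity.\<close>

lemma sublinear_dominates_linear:
  fixes p :: "'a::real_vector \<Rightarrow> real"
  assumes p: "sublinear p"
  obtains f where "linear f" "\<And>x. f x \<le> p x"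
proof -
  define D where "D = {q. sublinear q \<and> q \<le> p}"
  \<comment> \<open>The order is reversed, so the upper bounds asked for by Zorn's lemma are
    pointwise lower bounds.\<close>
  define R where "R q r \<longleftrightarrow> r \<le> q" for q r :: "'a \<Rightarrow> real"
  have po: "partial_order_on D (relation_of R D)"
    by (rule partial_order_on_relation_ofI) (auto simp: R_def)
  have "\<exists>m\<in>D. \<forall>q\<in>D. R m q \<longrightarrow> q = m"
  proof (rule predicate_Zorn[OF po])
    fix Ch
    assume "Ch \<in> Chains (relation_of R D)"
    then have ChD: "q \<in> D" and total: "q \<le> r \<or> r \<le> q" if "q \<in> Ch" "r \<in> Ch" for q r
      using that by (auto simp: Chains_def relation_of_def R_def)
    show "\<exists>u\<in>D. \<forall>q\<in>Ch. R q u"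
    proof (cases "Ch = {}")
      case True
      then show ?thesis using p by (auto simp: D_def)
    next
      case False
      define u where "u x = (INF q\<in>Ch. q x)" for x
      have sub: "sublinear q" and le_p: "q x \<le> p x" if "q \<in> Ch" for q x
        using ChD[OF that that] by (auto simp: D_def le_fun_def)
      \<comment> \<open>The bound does not depend on \<open>q\<close>, so the infimum over the chain
        is finite.\<close>
      have "- p (- x) \<le> q x" if "q \<in> Ch" for q x
        using sublinear_ge_uminus[OF sub[OF that], of x] le_p[OF that, of "- x"] by simp
      then have bdd: "bdd_below ((\<lambda>q. q x) ` Ch)" for x
        by (intro bdd_belowI2)
      have u_le: "u x \<le> q x" if "q \<in> Ch" for q x
        unfolding u_def using bdd that by (rule cINF_lower)
      have "sublinear u"
      proof (rule sublinearI)
        fix x y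
        \<comment> \<open>Members of a chain are comparable, so the smaller of \<open>q\<close> and
          \<open>r\<close> can serve at both \<open>x\<close> and \<open>y\<close>.\<close>
        have *: "u (x + y) \<le> q x + r y" if q: "q \<in> Ch" and r: "r \<in> Ch" for q r
          using total[OF q r]
        proof
          assume "q \<le> r"
          then have "q x + q y \<le> q x + r y" by (simp add: le_fun_def)
          then show ?thesis
            using u_le[OF q, of "x + y"] sublinear_add[OF sub[OF q], of x y] by linarith
        next
          assume "r \<le> q"
          then have "r x + r y \<le> q x + r y" by (simp add: le_fun_def)
          then show ?thesis
            using u_le[OF r, of "x + y"] sublinear_add[OF sub[OF r], of x y] by linarith
        qed
        have "u (x + y) - q x \<le> u y" if "q \<in> Ch" for q
          unfolding u_def[of y] using *[OF that] False
          by (intro cINF_greatest) (auto simp: algebra_simps)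
        then have "u (x + y) - u y \<le> u x"
          unfolding u_def[of x] using False by (intro cINF_greatest) (auto simp: algebra_simps)
        then show "u (x + y) \<le> u x + u y" by simp
      next
        fix c :: real and x
        assume c: "0 \<le> c"
        have *: "u (c *\<^sub>R x) \<le> c * q x" if "q \<in> Ch" for q
          using u_le[OF that, of "c *\<^sub>R x"] sublinear_scale[OF sub[OF that] c] by simp
        show "u (c *\<^sub>R x) \<le> c * u x"
        proof (cases "c = 0")
          case True
          with * False show ?thesis by auto
        next
          case False
          with c have "0 < c" by simp
          have "u (c *\<^sub>R x) / c \<le> u x"
            unfolding u_def[of x] using \<open>Ch \<noteq> {}\<close> * \<open>0 < c\<close>
            by (intro cINF_greatest) (auto simp: field_simps)
          with \<open>0 < c\<close> show ?thesis by (simp add: field_simps)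
        qed
      qed
      moreover have "u \<le> p"
        using False u_le le_p by (meson ex_in_conv le_funI order_trans)
      ultimately show ?thesis
        using u_le by (auto simp: D_def R_def le_fun_def)
    qed
  qed
  then obtain m where m: "sublinear m" "m \<le> p"
    and minimal: "\<And>q. sublinear q \<Longrightarrow> q \<le> m \<Longrightarrow> q = m"
    unfolding D_def R_def by (auto intro: order_trans)
  have "m (- y) = - m y" for y
  proof -
    obtain q where q: "sublinear q" "\<And>x. q x \<le> m x" "q (- y) \<le> - m y"
      using sublinear_lower[OF m(1), of "{y}" "m y"] by auto
    with minimal[of q] have "m (- y) \<le> - m y" by (auto simp: le_fun_def)
    with sublinear_ge_uminus[OF m(1), of y] show ?thesis by simp
  qed
  with m that show ?thesis
    by (auto simp: le_fun_def intro: sublinear_odd_imp_linear)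
qed

lemma sublinear_norm: "sublinear (norm :: 'a::real_normed_vector \<Rightarrow> real)"
  by (rule sublinearI) (auto simp: norm_triangle_ineq)

text \<open>The norm is lowered along \<open>S\<close>, and a linear \<open>f\<close> is chosen
  below the result. Then \<open>f (- s) \<le> - d\<close> on \<open>S\<close>, while domination by
  the norm at \<open>x\<close> and at \<open>- x\<close> bounds the absolute value.\<close>

lemma bounded_convex_support:
  fixes S :: "'a::real_normed_vector set"
  assumes "convex S" "S \<noteq> {}" "\<And>s. s \<in> S \<Longrightarrow> d \<le> norm s"
  obtains f where "bounded_linear f" "\<And>x. \<bar>f x\<bar> \<le> norm x" "\<And>s. s \<in> S \<Longrightarrow> d \<le> f s"
proof -
  obtain q where q: "sublinear q" "\<And>x. q x \<le> norm x" "\<And>s. s \<in> S \<Longrightarrow> q (- s) \<le> - d"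
    using sublinear_lower[OF sublinear_norm assms] by metis
  obtain f where f: "linear f" "\<And>x. f x \<le> q x"
    using sublinear_dominates_linear[OF q(1)] by metis
  have minus: "f (- x) = - f x" for x by (rule linear_neg[OF f(1)])
  have le: "f x \<le> norm x" for x using f(2)[of x] q(2)[of x] by linarith
  have abs: "\<bar>f x\<bar> \<le> norm x" for x
    using le[of x] le[of "- x"] by (simp add: minus)
  have "bounded_linear f"
    using f(1) abs by (auto intro!: bounded_linear.intro bounded_linear_axioms.intro exI[of _ 1])
  moreover have "d \<le> f s" if "s \<in> S" for s
    using q(3)[OF that] f(2)[of "- s"] by (simp add: minus)
  ultimately show ?thesis using abs that by blast
qed

lemma norming_functional:
  fixes x :: "'a::real_normed_vector"
  obtains f where "bounded_linear f" "\<And>y. \<bar>f y\<bar> \<le> norm y" "f x = norm x"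
proof (rule bounded_convex_support[of "{x}" "norm x"])
  fix f :: "'a \<Rightarrow> real"
  assume f: "bounded_linear f" "\<And>y. \<bar>f y\<bar> \<le> norm y" "\<And>s. s \<in> {x} \<Longrightarrow> norm x \<le> f s"
  from f(2)[of x] f(3)[of x] have "f x = norm x" by simp
  with f(1,2) show thesis by (rule that)
qed simp_all

section \<open>The weak topology\<close>

lemma linear_continuous_imp_bounded_linear:
  fixes f :: "'a::real_normed_vector \<Rightarrow> 'b::real_normed_vector"
  assumes f: "linear f" and cont: "continuous_on UNIV f"
  shows "bounded_linear f"
proof -
  have "isCont f 0" using cont by (simp add: continuous_on_eq_continuous_at)
  then have "\<forall>\<^sub>F x in nhds 0. dist (f x) (f 0) < 1"
    by (intro tendstoD) (simp_all add: isCont_def tendsto_at_iff_tendsto_nhds)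
  then obtain \<delta> where \<delta>: "0 < \<delta>" "\<And>x. norm x < \<delta> \<Longrightarrow> norm (f x) < 1"
    using linear_0[OF f] by (auto simp: eventually_nhds_metric)
  have "norm (f x) \<le> norm x * (2 / \<delta>)" for x
  proof (cases "x = 0")
    case False
    \<comment> \<open>The factor scales \<open>x\<close> to norm
      \<open>\<delta> / 2\<close>.\<close>
    define c where "c = \<delta> / (2 * norm x)"
    have "0 < c" using False \<delta>(1) by (simp add: c_def)
    have "norm (c *\<^sub>R x) < \<delta>" using False \<delta>(1) by (simp add: c_def)
    then have "norm (f (c *\<^sub>R x)) < 1" by (rule \<delta>(2))
    then have "c * norm (f x) < 1" using \<open>0 < c\<close> by (simp add: linear_scale[OF f])
    then have "norm (f x) < 1 / c" using \<open>0 < c\<close> by (simp add: field_simps)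
    then show ?thesis by (simp add: c_def mult.commute)
  qed (simp add: linear_0[OF f])
  with f show ?thesis
    by (intro bounded_linear.intro bounded_linear_axioms.intro exI[of _ "2 / \<delta>"] allI)
qed

lemma openin_weak_topology_vimage:
  fixes f :: "'a::real_normed_vector \<Rightarrow> real"
  assumes "bounded_linear f" "open U"
  shows "openin weak_topology (f -` U)"
  unfolding weak_topology_def
  by (intro topology_generated_by_Basis CollectI exI[of _ f] exI[of _ U] conjI refl assms(2)
      bounded_linear.linear[OF assms(1)] linear_continuous_on[OF assms(1)])

lemma topspace_weak_topology [simp]: "topspace weak_topology = UNIV"
proof -
  have "openin weak_topology ((\<lambda>x::'a. 0::real) -` UNIV)"
    by (rule openin_weak_topology_vimage) auto
  then show ?thesis using openin_subset by fastforce
qed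

lemma continuous_map_weak_topology:
  assumes "bounded_linear f"
  shows "continuous_map weak_topology euclideanreal f"
  using openin_weak_topology_vimage[OF assms]
  by (auto simp: continuous_map_def vimage_def)

text \<open>That testing on functionals suffices is shown by induction over the generation of the
  weak topology: finite intersections and unions are formal, and a subbasic set involves a single
  functional.\<close>

lemma weakly_converges_iff:
  "weakly_converges u x \<longleftrightarrow> (\<forall>f. bounded_linear f \<longrightarrow> (\<lambda>k. f (u k) :: real) \<longlonglongrightarrow> f x)"
proof (intro iffI allI impI)
  fix f :: "'a \<Rightarrow> real"
  assume "weakly_converges u x" "bounded_linear f"
  then have "limitin euclideanreal (f \<circ> u) (f x) sequentially"
    unfolding weakly_converges_def
    by (intro continuous_map_limit[OF continuous_map_weak_topology])
  then show "(\<lambda>k. f (u k)) \<longlonglongrightarrow> f x" by (simp add: o_def)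
next
  assume lim: "\<forall>f. bounded_linear f \<longrightarrow> (\<lambda>k. f (u k) :: real) \<longlonglongrightarrow> f x"
  have "x \<in> U \<Longrightarrow> \<forall>\<^sub>F k in sequentially. u k \<in> U"
    if "generate_topology_on
      {f -` V | (f :: 'a \<Rightarrow> real) V. linear f \<and> continuous_on UNIV f \<and> open V} U" for U
    using that
  proof induction
    case (Int a b)
    then show ?case by (simp add: eventually_conj)
  next
    case (UN K)
    then obtain k where "k \<in> K" "x \<in> k" by blast
    with UN have "\<forall>\<^sub>F m in sequentially. u m \<in> k" by blast
    then show ?case by (rule eventually_mono) (use \<open>k \<in> K\<close> in blast)
  next
    case (Basis s)
    then obtain f :: "'a \<Rightarrow> real" and V where s: "s = f -` V" and f: "linear f" "continuous_on UNIV f" and V: "open V"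
      by auto
    have "bounded_linear f"
      using f by (simp add: linear_continuous_imp_bounded_linear)
    then have "(\<lambda>k. f (u k)) \<longlonglongrightarrow> f x" using lim by simp
    moreover have "f x \<in> V" using \<open>x \<in> s\<close> s by simp
    ultimately have "\<forall>\<^sub>F k in sequentially. f (u k) \<in> V"
      using V by (intro topological_tendstoD)
    then show ?case by (simp add: s)
  qed simp
  moreover have "x \<in> topspace weak_topology" by simp
  ultimately show "weakly_converges u x"
    unfolding weakly_converges_def limitin_def weak_topology_def openin_topology_generated_by_iff
    by simp
qed

text \<open>A norming functional for \<open>x - y\<close> would tell two distinct points
  apart.\<close>

lemma bounded_linear_eq_imp_eq:
  fixes x y :: "'a::real_normed_vector"
  assumes "\<And>f :: 'a \<Rightarrow> real. bounded_linear f \<Longrightarrow> f x = f y"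
  shows "x = y"
proof -
  obtain f :: "'a \<Rightarrow> real" where f: "bounded_linear f" "f (x - y) = norm (x - y)"
    using norming_functional by metis
  then have "norm (x - y) = f x - f y"
    by (simp add: linear_diff bounded_linear.linear)
  with assms[OF f(1)] show ?thesis by simp
qed

lemma weakly_converges_unique:
  assumes "weakly_converges u x" "weakly_converges u y"
  shows "x = y"
  using assms unfolding weakly_converges_iff
  by (blast intro: bounded_linear_eq_imp_eq LIMSEQ_unique)

lemma weakly_converges_subseq:
  assumes "weakly_converges u x" "strict_mono r"
  shows "weakly_converges (\<lambda>k. u (r k)) x"
  using assms LIMSEQ_subseq_LIMSEQ unfolding weakly_converges_iff by (fastforce simp: o_def)

lemma tendsto_imp_weakly_converges: "u \<longlonglongrightarrow> x \<Longrightarrow> weakly_converges u x"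
  by (auto simp: weakly_converges_iff intro: bounded_linear.tendsto)

text \<open>Mazur's theorem. If \<open>x\<close> has distance \<open>d > 0\<close> from
  \<open>S\<close>, some functional is at least \<open>d\<close> on the translate of
  \<open>S\<close> by \<open>- x\<close>, so the weakly open half-space \<open>f < f x + d\<close>
  contains \<open>x\<close> and misses \<open>S\<close>.\<close>

lemma closedin_weak_topology_closed_convex:
  fixes S :: "'a::real_normed_vector set"
  assumes "closed S" "convex S"
  shows "closedin weak_topology S"
proof -
  have "\<exists>U. openin weak_topology U \<and> x \<in> U \<and> U \<subseteq> - S" if "x \<notin> S" for x
  proof (cases "S = {}")
    case True
    then show ?thesis by (metis Compl_empty_eq openin_topspace subset_UNIV topspace_weak_topology UNIV_I)
  next
    case False
    have "0 < infdist x S"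
      using that assms(1) False by (simp add: infdist_pos_not_in_closed)
    let ?d = "infdist x S" and ?T = "(\<lambda>s. s - x) ` S"
    have "?d \<le> norm t" if "t \<in> ?T" for t
      using that infdist_le[of _ S x] by (auto simp: dist_norm norm_minus_commute)
    moreover have "convex ?T"
      using assms(2) convex_translation[of S "- x"] by (simp add: image_def)
    ultimately obtain f :: "'a \<Rightarrow> real" where f: "bounded_linear f" "\<And>t. t \<in> ?T \<Longrightarrow> ?d \<le> f t"
      using bounded_convex_support[of ?T ?d] False by (metis image_is_empty)
    have "f x + ?d \<le> f s" if "s \<in> S" for s
      using f(2)[of "s - x"] that by (simp add: linear_diff bounded_linear.linear[OF f(1)])
    then have "f -` {..<f x + ?d} \<subseteq> - S" by force
    moreover have "x \<in> f -` {..<f x + ?d}" using \<open>0 < ?d\<close> by simp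
    ultimately show ?thesis
      using openin_weak_topology_vimage[OF f(1) open_lessThan] by blast
  qed
  then have "openin weak_topology (- S)"
    by (subst openin_subopen) blast
  then show ?thesis by (simp add: closedin_def Compl_eq_Diff_UNIV)
qed

lemma weakly_converges_in_closed_convex:
  assumes "closed S" "convex S" "weakly_converges u x" "\<And>k. u k \<in> S"
  shows "x \<in> S"
proof -
  have "closedin weak_topology S"
    using assms(1,2) by (rule closedin_weak_topology_closed_convex)
  with assms(3,4) show ?thesis
    unfolding weakly_converges_def by (intro limitin_closedin[of weak_topology u x]) auto
qed

lemma weakly_seq_continuous_onD:
  "weakly_seq_continuous_on D T \<Longrightarrow> weakly_converges u x \<Longrightarrow> (\<And>k. u k \<in> D) \<Longrightarrow> x \<in> D \<Longrightarrow>
    weakly_converges (\<lambda>k. T (u k)) (T x)"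
  by (simp add: weakly_seq_continuous_on_def)

lemma weakly_converges_mult:
  fixes x y :: "'a::real_normed_algebra"
  assumes "condition_GP TYPE('a)" "weakly_converges u x" "weakly_converges v y"
  shows "weakly_converges (\<lambda>k. u k * v k) (x * y)"
  using assms by (simp add: condition_GP_def)

lemma weakly_converges_add:
  assumes "weakly_converges u x" "weakly_converges v y"
  shows "weakly_converges (\<lambda>k. u k + v k) (x + y)"
  using assms unfolding weakly_converges_iff
  by (simp add: linear_add bounded_linear.linear tendsto_add)

section \<open>Metrizability of weakly compact sets\<close>

text \<open>This gives the reduction to a separable set. Closing \<open>D0\<close> alternately under
  \<open>T\<close> and under rational convex combinations takes countably many steps and adds
  countably many points each time.\<close>

lemma countable_invariant_superset:
  fixes S :: "'a::real_normed_vector set"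
  assumes D0: "countable D0" "D0 \<subseteq> S" and S: "convex S" and T: "T ` S \<subseteq> S"
  obtains D where "countable D" "D \<subseteq> S" "D0 \<subseteq> D" "T ` D \<subseteq> D" "convex (closure D)"
proof -
  \<comment> \<open>Clipping the coefficient to the unit interval keeps \<open>comb\<close>
    continuous and convex-valued for every real \<open>q\<close>.\<close>
  define c :: "real \<Rightarrow> real" where "c q = max 0 (min 1 q)" for q
  define comb where "comb = (\<lambda>(q, x, y :: 'a). (1 - c q) *\<^sub>R x + c q *\<^sub>R y)"
  define step where "step E = E \<union> T ` E \<union> comb ` (\<rat> \<times> E \<times> E)" for E
  define E where "E k = (step ^^ k) D0" for k
  define D where "D = (\<Union>k. E k)"
  have Suc: "E (Suc k) = step (E k)" for k by (simp add: E_def)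
  have "countable (E k) \<and> E k \<subseteq> S" for k
  proof (induction k)
    case 0
    with D0 show ?case by (simp add: E_def)
  next
    case (Suc k)
    have "comb (q, x, y) \<in> S" if "x \<in> E k" "y \<in> E k" for q x y
    proof -
      have "x \<in> S" "y \<in> S" using that Suc by auto
      moreover have "0 \<le> c q" "c q \<le> 1" by (auto simp: c_def)
      ultimately show ?thesis unfolding comb_def by (simp add: convexD_alt[OF S])
    qed
    moreover have "countable (step (E k))"
      unfolding step_def using Suc by (intro countable_Un countable_image countable_SIGMA countable_rat) auto
    ultimately show ?case using Suc T unfolding \<open>E (Suc k) = step (E k)\<close> step_def by blast
  qed
  then have "countable D" "D \<subseteq> S" unfolding D_def by blast+
  moreover have "D0 \<subseteq> D" unfolding D_def by (metis E_def UN_upper UNIV_I funpow_0)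
  moreover have "T ` D \<subseteq> D"
  proof (rule image_subsetI)
    fix x
    assume "x \<in> D"
    then obtain k where "x \<in> E k" by (auto simp: D_def)
    then have "T x \<in> E (Suc k)" by (simp add: Suc step_def)
    then show "T x \<in> D" by (auto simp: D_def)
  qed
  moreover have "convex (closure D)"
  proof -
    have mono: "E i \<subseteq> E j" if "i \<le> j" for i j
      by (rule lift_Suc_mono_le[OF _ that]) (auto simp: Suc step_def)
    have "comb (q, x, y) \<in> D" if q: "q \<in> \<rat>" and xy: "x \<in> D" "y \<in> D" for q x y
    proof -
      obtain i j where "x \<in> E i" "y \<in> E j" using xy by (auto simp: D_def)
      then have "x \<in> E (max i j)" "y \<in> E (max i j)"
        using mono[of i "max i j"] mono[of j "max i j"] by auto
      with q have "comb (q, x, y) \<in> E (Suc (max i j))" by (simp add: Suc step_def)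
      then show ?thesis by (auto simp: D_def)
    qed
    then have "comb ` (\<rat> \<times> D \<times> D) \<subseteq> closure D" using closure_subset by fastforce
    \<comment> \<open>Rationals are dense in the reals, so continuity of \<open>comb\<close> carries
      the inclusion from rational coefficients and points of \<open>D\<close> to real ones and
      points of the closure.\<close>
    moreover have "continuous_on (closure (\<rat> \<times> D \<times> D)) comb"
      unfolding comb_def c_def case_prod_beta by (intro continuous_intros)
    ultimately have *: "comb ` closure (\<rat> \<times> D \<times> D) \<subseteq> closure D"
      by (intro image_closure_subset) auto
    show ?thesis
      unfolding convex_alt
    proof (intro ballI allI impI)
      fix x y u
      assume "x \<in> closure D" "y \<in> closure D" and u: "0 \<le> u \<and> u \<le> (1::real)"
      then have "comb (u, x, y) \<in> closure D"
        using * by (auto simp: closure_Times Rats_closure_real image_subset_iff)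
      with u show "(1 - u) *\<^sub>R x + u *\<^sub>R y \<in> closure D"
        by (simp add: comb_def c_def)
    qed
  qed
  ultimately show ?thesis by (rule that)
qed

text \<open>Functionals norming the differences of points of \<open>D\<close> separate the points of
  \<open>W\<close>. A continuous injection of a compact space into a Hausdorff space is a
  homeomorphism onto its image, so the inverse \<open>g\<close> is weakly continuous.\<close>

lemma weakly_compact_embedding:
  fixes W :: "'a::real_normed_vector set"
  assumes W: "compactin weak_topology W" and D: "countable D" "W \<subseteq> closure D"
  obtains G :: "'a \<Rightarrow> nat \<Rightarrow> real" and g where
    "\<And>u x. weakly_converges u x \<Longrightarrow> (\<lambda>k. G (u k)) \<longlonglongrightarrow> G x"
    "\<And>x. x \<in> W \<Longrightarrow> g (G x) = x"
    "compact (G ` W)"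
    "\<And>f :: 'a \<Rightarrow> real. bounded_linear f \<Longrightarrow> continuous_on (G ` W) (\<lambda>p. f (g p))"
proof -
  have "\<forall>a b. \<exists>f :: 'a \<Rightarrow> real. bounded_linear f \<and> (\<forall>y. \<bar>f y\<bar> \<le> norm y) \<and> f (a - b) = norm (a - b)"
    by (metis norming_functional)
  then obtain h :: "'a \<Rightarrow> 'a \<Rightarrow> 'a \<Rightarrow> real" where h: "\<And>a b. bounded_linear (h a b)"
      "\<And>a b y. \<bar>h a b y\<bar> \<le> norm y" "\<And>a b. h a b (a - b) = norm (a - b)"
    by metis
  define d where "d = from_nat_into D"
  \<comment> \<open>Coordinate \<open>i\<close> codes a pair of indices into the enumeration of
    \<open>D\<close>.\<close>
  define G where "G x i = h (d (fst (prod_decode i))) (d (snd (prod_decode i))) x" for x i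
  have lin: "bounded_linear (\<lambda>x. G x i)" for i
    unfolding G_def by (rule h(1))
  have inj: "inj_on G W"
  proof (rule inj_onI, rule ccontr)
    fix x y
    assume xy: "x \<in> W" "y \<in> W" "G x = G y" "x \<noteq> y"
    \<comment> \<open>If \<open>G x = G y\<close>, then \<open>a\<close> and \<open>b\<close> are
      less than \<open>2 * e\<close> apart, hence \<open>x\<close> and \<open>y\<close> less than
      \<open>4 * e\<close>, which is their distance.\<close>
    define e where "e = norm (x - y) / 4"
    have "0 < e" using xy by (simp add: e_def)
    obtain a where a: "a \<in> D" "dist a x < e"
      using xy(1) D(2) \<open>0 < e\<close> by (meson closure_approachable subsetD)
    obtain b where b: "b \<in> D" "dist b y < e"
      using xy(2) D(2) \<open>0 < e\<close> by (meson closure_approachable subsetD)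
    obtain i j where ij: "a = d i" "b = d j"
      using a(1) b(1) D(1) unfolding d_def by (metis from_nat_into_surj)
    have "G x (prod_encode (i, j)) = G y (prod_encode (i, j))" using xy(3) by simp
    then have "h a b x = h a b y" by (simp add: G_def ij)
    then have "h a b (a - b) = h a b (a - x) - h a b (b - y)"
      by (simp add: linear_diff bounded_linear.linear[OF h(1)])
    then have "norm (a - b) \<le> norm (a - x) + norm (b - y)"
      using h(2)[of a b "a - x"] h(2)[of a b "b - y"] by (simp add: h(3))
    moreover have "norm (x - y) \<le> norm (a - b) + norm (a - x) + norm (b - y)"
      using norm_triangle_ineq4[of "a - b" "(a - x) - (b - y)"] norm_triangle_ineq4[of "a - x" "b - y"]
      by simp
    ultimately show False
      using a(2) b(2) \<open>0 < e\<close> by (simp add: e_def dist_norm)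
  qed
  let ?X = "subtopology weak_topology W" and ?Y = "top_of_set (G ` W)"
  have "continuous_map weak_topology (product_topology (\<lambda>_. euclideanreal) UNIV) G"
    unfolding continuous_map_componentwise_UNIV using continuous_map_weak_topology[OF lin] by simp
  then have cont: "continuous_map weak_topology euclidean G"
    by (simp add: euclidean_product_topology)
  have compact: "compact (G ` W)"
    using image_compactin[OF W cont] by simp
  have "homeomorphic_map ?X ?Y G"
  proof (rule continuous_imp_homeomorphic_map)
    show "compact_space ?X" using W by (rule compact_space_subtopology)
    show "Hausdorff_space ?Y" by (simp add: Hausdorff_space_subtopology)
    show "continuous_map ?X ?Y G"
      using cont by (auto simp: continuous_map_in_subtopology intro: continuous_map_from_subtopology)
  qed (use inj in auto)
  then obtain g where g: "homeomorphic_maps ?X ?Y G g"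
    using homeomorphic_map_maps by blast
  then have gG: "g (G x) = x" if "x \<in> W" for x
    using that by (simp add: homeomorphic_maps_def)
  have "continuous_map ?Y weak_topology g"
    using g by (simp add: homeomorphic_maps_def continuous_map_in_subtopology)
  have "continuous_on (G ` W) (\<lambda>p. f (g p))" if "bounded_linear f" for f :: "'a \<Rightarrow> real"
    using continuous_map_compose[OF \<open>continuous_map ?Y weak_topology g\<close> continuous_map_weak_topology[OF that]]
    by (simp add: o_def)
  note cont_inverse = this
  have "(\<lambda>k. G (u k)) \<longlonglongrightarrow> G x" if u: "weakly_converges u x" for u x
    using continuous_map_limit[OF cont u[unfolded weakly_converges_def]] by (simp add: o_def)
  from this gG compact cont_inverse show ?thesis by (rule that)
qed

text \<open>One half of the Eberlein-Smulian theorem. The sequence stays in the part of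
  \<open>W\<close> inside a separable closed convex set; this part is again weakly compact and
  embeds into a metric space.\<close>

lemma weakly_compact_imp_convergent_subseq:
  fixes u :: "nat \<Rightarrow> 'a::real_normed_vector"
  assumes W: "compactin weak_topology W" and u: "\<And>k. u k \<in> W"
  obtains r x where "strict_mono r" "x \<in> W" "weakly_converges (\<lambda>k. u (r k)) x"
proof -
  obtain D :: "'a set" where D: "countable D" "range u \<subseteq> D" "convex (closure D)"
    using countable_invariant_superset[of "range u" UNIV id]
    by (metis convex_UNIV countable_image countableI_type image_id subset_UNIV id_apply)
  let ?W = "closure D \<inter> W"
  have cW: "compactin weak_topology ?W"
    using D(3) W by (intro closed_Int_compactin closedin_weak_topology_closed_convex) auto
  have uW: "u k \<in> ?W" for k
    using u D(2) closure_subset[of D] by blast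
  show ?thesis
  proof (rule weakly_compact_embedding[OF cW D(1) Int_lower1])
    fix G :: "'a \<Rightarrow> nat \<Rightarrow> real" and g
    assume Gg: "\<And>x. x \<in> ?W \<Longrightarrow> g (G x) = x"
      and compact: "compact (G ` ?W)"
      and cont: "\<And>f :: 'a \<Rightarrow> real. bounded_linear f \<Longrightarrow> continuous_on (G ` ?W) (\<lambda>p. f (g p))"
    have "seq_compact (G ` ?W)" using compact by (rule compact_imp_seq_compact)
    moreover have "\<forall>k. (G \<circ> u) k \<in> G ` ?W" using uW by auto
    ultimately obtain p r where p: "p \<in> G ` ?W" and r: "strict_mono r" and lim: "((G \<circ> u) \<circ> r) \<longlonglongrightarrow> p"
      unfolding seq_compact_def by blast
    then obtain x where x: "x \<in> ?W" "p = G x" by blast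
    have "(\<lambda>k. f (u (r k))) \<longlonglongrightarrow> f x" if "bounded_linear f" for f :: "'a \<Rightarrow> real"
    proof -
      have "(\<lambda>k. f (g (((G \<circ> u) \<circ> r) k))) \<longlonglongrightarrow> f (g p)"
        using uW by (intro continuous_on_tendsto_compose[OF cont[OF that] lim p]) auto
      then show ?thesis using Gg uW x by simp
    qed
    then have "weakly_converges (\<lambda>k. u (r k)) x" unfolding weakly_converges_iff by blast
    with r IntD2[OF x(1)] show thesis by (rule that)
  qed
qed

section \<open>Brouwer's theorem for cubes of arbitrary dimension\<close>

text \<open>Coordinates from \<open>n\<close> on are fixed at 0, so cubes of all dimensions live in
  one type and \<open>n\<close> may be an ordinary variable.\<close>

definition unit_cube :: "nat \<Rightarrow> (nat \<Rightarrow> real) set" where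
  "unit_cube n = {x. (\<forall>i<n. 0 \<le> x i \<and> x i \<le> 1) \<and> (\<forall>i\<ge>n. x i = 0)}"

lemma tendsto_fun_iff:
  fixes u :: "'b \<Rightarrow> 'i \<Rightarrow> 'c::topological_space"
  shows "(u \<longlongrightarrow> l) F \<longleftrightarrow> (\<forall>i. ((\<lambda>k. u k i) \<longlongrightarrow> l i) F)"
  using limitin_componentwise[of "\<lambda>_::'i. euclidean :: 'c topology" UNIV u l F]
  by (simp add: euclidean_product_topology)

lemma compact_unit_cube: "compact (unit_cube n)"
proof -
  let ?I = "\<lambda>i. if i < n then {0..1} else {0::real}"
  have "x \<in> unit_cube n \<longleftrightarrow> (\<forall>i. x i \<in> ?I i)" for x
    unfolding unit_cube_def by (simp add: all_conj_distrib if_distrib) (meson linorder_not_less)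
  then have "unit_cube n = PiE UNIV ?I"
    by (simp add: set_eq_iff PiE_UNIV_domain Pi_iff)
  moreover have "compactin (product_topology (\<lambda>_. euclideanreal) UNIV) (PiE UNIV ?I)"
    unfolding compactin_PiE by (intro disjI2 ballI) simp
  ultimately show ?thesis
    by (simp add: euclidean_product_topology)
qed

text \<open>Kuhn's combinatorial lemma on ever finer grids gives, for each coordinate, two nearby
  points at which \<open>f\<close> moves that coordinate in opposite directions. Both inequalities
  survive in a common limit.\<close>

lemma brouwer_unit_cube:
  assumes cont: "continuous_on (unit_cube n) f"
    and maps: "\<And>x. x \<in> unit_cube n \<Longrightarrow> f x \<in> unit_cube n"
  obtains x where "x \<in> unit_cube n" "f x = x"
proof -
  let ?Q = "unit_cube n"
  have "\<exists>l. (\<forall>x i. l x i \<le> (1::nat)) \<and>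
      (\<forall>x i. x \<in> ?Q \<and> i < n \<and> x i = 0 \<longrightarrow> l x i = 0) \<and>
      (\<forall>x i. x \<in> ?Q \<and> i < n \<and> x i = 1 \<longrightarrow> l x i = 1) \<and>
      (\<forall>x i. x \<in> ?Q \<and> i < n \<and> l x i = 0 \<longrightarrow> x i \<le> f x i) \<and>
      (\<forall>x i. x \<in> ?Q \<and> i < n \<and> l x i = 1 \<longrightarrow> f x i \<le> x i)"
    by (rule kuhn_labelling_lemma') (auto simp: maps, auto simp: unit_cube_def)
  then obtain l :: "(nat \<Rightarrow> real) \<Rightarrow> nat \<Rightarrow> nat"
    where l01: "\<And>x i. l x i \<le> 1"
      and l0: "\<And>x i. x \<in> ?Q \<Longrightarrow> i < n \<Longrightarrow> x i = 0 \<Longrightarrow> l x i = 0"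
      and l1: "\<And>x i. x \<in> ?Q \<Longrightarrow> i < n \<Longrightarrow> x i = 1 \<Longrightarrow> l x i = 1"
      and l0D: "\<And>x i. x \<in> ?Q \<Longrightarrow> i < n \<Longrightarrow> l x i = 0 \<Longrightarrow> x i \<le> f x i"
      and l1D: "\<And>x i. x \<in> ?Q \<Longrightarrow> i < n \<Longrightarrow> l x i = 1 \<Longrightarrow> f x i \<le> x i"
    by blast
  \<comment> \<open>The points \<open>a\<close> and \<open>b\<close> lie within the mesh size of
    \<open>z\<close> and witness the two opposite inequalities in coordinate
    \<open>i\<close>.\<close>
  define R where "R m z i a b \<longleftrightarrow> a \<in> ?Q \<and> b \<in> ?Q \<and>
      (\<forall>j. \<bar>a j - z j\<bar> \<le> inverse (real (Suc m))) \<and>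
      (\<forall>j. \<bar>b j - z j\<bar> \<le> inverse (real (Suc m))) \<and>
      a i \<le> f a i \<and> f b i \<le> b i" for m z i a b
  have "\<exists>z a b. z \<in> ?Q \<and> (\<forall>i<n. R m z i (a i) (b i))" for m
  proof -
    define p where "p = Suc m"
    define g where "g q = (\<lambda>i. if i < n then real (q i) / real p else 0)" for q :: "nat \<Rightarrow> nat"
    have gQ: "g q \<in> ?Q" if "\<forall>i<n. q i \<le> p" for q
      using that by (auto simp: g_def unit_cube_def p_def)
    obtain q where q: "\<forall>i<n. q i < p"
      and rs: "\<forall>i<n. \<exists>r s. (\<forall>j<n. q j \<le> r j \<and> r j \<le> q j + 1) \<and>
        (\<forall>j<n. q j \<le> s j \<and> s j \<le> q j + 1) \<and> l (g r) i \<noteq> l (g s) i"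
    proof (rule kuhn_lemma[of p n "\<lambda>q. l (g q)"])
      show "0 < p" by (simp add: p_def)
      show "\<forall>x. (\<forall>i<n. x i \<le> p) \<longrightarrow> (\<forall>i<n. l (g x) i = 0 \<or> l (g x) i = 1)"
        using l01 by (metis le_less_linear less_one order_antisym)
      show "\<forall>x. (\<forall>i<n. x i \<le> p) \<longrightarrow> (\<forall>i<n. x i = 0 \<longrightarrow> l (g x) i = 0)"
        using l0 gQ by (simp add: g_def)
      show "\<forall>x. (\<forall>i<n. x i \<le> p) \<longrightarrow> (\<forall>i<n. x i = p \<longrightarrow> l (g x) i = 1)"
        using l1 gQ by (simp add: g_def p_def)
    qed
    have near: "\<bar>g r j - g q j\<bar> \<le> inverse (real (Suc m))"
      if "\<forall>j<n. q j \<le> r j \<and> r j \<le> q j + 1" for r j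
    proof (cases "j < n")
      case True
      with that have "q j \<le> r j" "r j \<le> q j + 1" by blast+
      then have "\<bar>real (r j) - real (q j)\<bar> \<le> 1" by linarith
      then have "\<bar>real (r j) - real (q j)\<bar> / real p \<le> 1 / real p"
        by (rule divide_right_mono) simp
      with True show ?thesis
        by (simp add: g_def p_def diff_divide_distrib[symmetric] inverse_eq_divide)
    qed (simp add: g_def)
    have "\<exists>a b. R m (g q) i a b" if i: "i < n" for i
    proof -
      obtain r s where r: "\<forall>j<n. q j \<le> r j \<and> r j \<le> q j + 1"
        and s: "\<forall>j<n. q j \<le> s j \<and> s j \<le> q j + 1" and ne: "l (g r) i \<noteq> l (g s) i"
        using rs i by blast
      have rQ: "g r \<in> ?Q" using r q by (intro gQ) (metis Suc_eq_plus1 Suc_leI le_trans)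
      have sQ: "g s \<in> ?Q" using s q by (intro gQ) (metis Suc_eq_plus1 Suc_leI le_trans)
      have "l (g r) i = 0 \<and> l (g s) i = 1 \<or> l (g r) i = 1 \<and> l (g s) i = 0"
        using ne l01[of "g r" i] l01[of "g s" i] by linarith
      then show ?thesis
      proof
        assume "l (g r) i = 0 \<and> l (g s) i = 1"
        then show ?thesis
          using rQ sQ near[OF r] near[OF s] l0D[OF rQ i] l1D[OF sQ i]
          unfolding R_def by blast
      next
        assume "l (g r) i = 1 \<and> l (g s) i = 0"
        then show ?thesis
          using rQ sQ near[OF r] near[OF s] l1D[OF rQ i] l0D[OF sQ i]
          unfolding R_def by blast
      qed
    qed
    then obtain a b where "\<forall>i<n. R m (g q) i (a i) (b i)" by metis
    moreover have "g q \<in> ?Q" using q by (intro gQ) (auto intro: less_imp_le)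
    ultimately show ?thesis by blast
  qed
  then obtain z a b where zQ: "\<And>m. z m \<in> ?Q"
    and R: "\<And>m i. i < n \<Longrightarrow> R m (z m) i (a m i) (b m i)" by metis
  have "seq_compact ?Q" by (simp add: compact_imp_seq_compact compact_unit_cube)
  then obtain x \<sigma> where x: "x \<in> ?Q" and \<sigma>: "strict_mono \<sigma>" and lim: "(z \<circ> \<sigma>) \<longlonglongrightarrow> x"
    using zQ unfolding seq_compact_def by blast
  have null: "(\<lambda>k. inverse (real (Suc (\<sigma> k)))) \<longlonglongrightarrow> 0"
    using LIMSEQ_subseq_LIMSEQ[OF LIMSEQ_inverse_real_of_nat \<sigma>] by (simp add: o_def)
  \<comment> \<open>Points within the shrinking mesh of the grid points inherit their limit.\<close>
  have shadow: "c \<longlonglongrightarrow> x" "(\<lambda>k. f (c k)) \<longlonglongrightarrow> f x"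
    if near: "\<And>k j. \<bar>c k j - z (\<sigma> k) j\<bar> \<le> inverse (real (Suc (\<sigma> k)))" and cQ: "\<And>k. c k \<in> ?Q"
    for c :: "nat \<Rightarrow> nat \<Rightarrow> real"
  proof -
    have "(\<lambda>k. c k j) \<longlonglongrightarrow> x j" for j
    proof -
      have "(\<lambda>k. c k j - z (\<sigma> k) j) \<longlonglongrightarrow> 0"
        by (rule Lim_null_comparison[OF _ null]) (simp add: near del: of_nat_Suc)
      moreover have "(\<lambda>k. z (\<sigma> k) j) \<longlonglongrightarrow> x j"
        using lim by (simp add: tendsto_fun_iff)
      ultimately have "(\<lambda>k. (c k j - z (\<sigma> k) j) + z (\<sigma> k) j) \<longlonglongrightarrow> 0 + x j"
        by (rule tendsto_add)
      then show ?thesis by simp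
    qed
    then show c: "c \<longlonglongrightarrow> x" by (simp add: tendsto_fun_iff)
    have "(f \<circ> c) \<longlonglongrightarrow> f x"
      using cont[unfolded continuous_on_sequentially] x cQ c by blast
    then show "(\<lambda>k. f (c k)) \<longlonglongrightarrow> f x" by (simp add: o_def)
  qed
  have "f x i = x i" for i
  proof (cases "i < n")
    case True
    have a: "a (\<sigma> k) i \<in> ?Q" "\<bar>a (\<sigma> k) i j - z (\<sigma> k) j\<bar> \<le> inverse (real (Suc (\<sigma> k)))"
      "a (\<sigma> k) i i \<le> f (a (\<sigma> k) i) i" for k j
      using R[OF True, of "\<sigma> k"] unfolding R_def by blast+
    have b: "b (\<sigma> k) i \<in> ?Q" "\<bar>b (\<sigma> k) i j - z (\<sigma> k) j\<bar> \<le> inverse (real (Suc (\<sigma> k)))"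
      "f (b (\<sigma> k) i) i \<le> b (\<sigma> k) i i" for k j
      using R[OF True, of "\<sigma> k"] unfolding R_def by blast+
    note A = shadow[of "\<lambda>k. a (\<sigma> k) i", OF a(2,1), unfolded tendsto_fun_iff, rule_format, of i]
    note B = shadow[of "\<lambda>k. b (\<sigma> k) i", OF b(2,1), unfolded tendsto_fun_iff, rule_format, of i]
    have "x i \<le> f x i"
      using a(3) by (intro LIMSEQ_le[OF A]) blast
    moreover have "f x i \<le> x i"
      using b(3) by (intro LIMSEQ_le[OF B(2,1)]) blast
    ultimately show ?thesis by simp
  next
    case False
    with x maps[OF x] show ?thesis by (simp add: unit_cube_def)
  qed
  then have "f x = x" by (rule ext)
  then show ?thesis by (rule that[OF x])
qed

section \<open>Fixed points of weakly sequentially continuous maps\<close>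

text \<open>Brouwer's theorem is applied to the coefficients: \<open>t\<close> in the cube
  determines a point \<open>\<sigma> t\<close> of \<open>S\<close>, whose values under the
  \<open>\<phi> i\<close> form the next \<open>t\<close>.\<close>

lemma finite_rank_fixed_point:
  fixes S :: "'a::real_normed_vector set" and w :: "nat \<Rightarrow> 'a" and \<phi> :: "nat \<Rightarrow> 'a \<Rightarrow> real"
  assumes S: "convex S" and x0: "x0 \<in> S" and w: "\<And>i. i < n \<Longrightarrow> w i \<in> S"
    and nonneg: "\<And>i x. i < n \<Longrightarrow> x \<in> S \<Longrightarrow> 0 \<le> \<phi> i x"
    and sum1: "\<And>x. x \<in> S \<Longrightarrow> (\<Sum>i<n. \<phi> i x) = 1"
    and cont: "\<And>i. i < n \<Longrightarrow> continuous_on S (\<phi> i)"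
  shows "\<exists>x\<in>S. x = (\<Sum>i<n. \<phi> i x *\<^sub>R w i)"
proof -
  define v where "v i = (if i < n then w i else x0)" for i
  define s where "s t = (\<Sum>i<n. t i)" for t :: "nat \<Rightarrow> real"
  \<comment> \<open>These are convex weights for every \<open>t\<close> in the cube: a sum below 1
    is topped up by weight on \<open>x0\<close>, a sum above 1 is normalized.\<close>
  define \<beta> where "\<beta> t i = (if i < n then t i else max 0 (1 - s t)) / max 1 (s t)" for t i
  define \<sigma> where "\<sigma> t = (\<Sum>i\<le>n. \<beta> t i *\<^sub>R v i)" for t
  define F where "F t i = (if i < n then \<phi> i (\<sigma> t) else 0)" for t i
  have \<sigma>S: "\<sigma> t \<in> S" if "t \<in> unit_cube n" for t
    unfolding \<sigma>_def
  proof (rule convex_sum[OF _ S])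
    have "(\<Sum>i\<le>n. \<beta> t i) = (s t + max 0 (1 - s t)) / max 1 (s t)"
      by (simp add: \<beta>_def s_def lessThan_Suc_atMost[symmetric] add_divide_distrib sum_divide_distrib)
    also have "\<dots> = 1" by (auto simp: max_def)
    finally show "(\<Sum>i\<le>n. \<beta> t i) = 1" .
    show "0 \<le> \<beta> t i" for i using that by (auto simp: \<beta>_def unit_cube_def)
    show "v i \<in> S" for i using w x0 by (simp add: v_def)
  qed simp
  have coord: "continuous_on (unit_cube n) (\<lambda>t. t i)" for i
    by (rule continuous_on_product_coordinates[THEN continuous_on_subset]) simp
  have cont_\<beta>: "continuous_on (unit_cube n) (\<lambda>t. \<beta> t i)" for i
    unfolding \<beta>_def s_def by (cases "i < n") (auto intro!: continuous_intros coord)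
  have cont_\<sigma>: "continuous_on (unit_cube n) \<sigma>"
    unfolding \<sigma>_def by (intro continuous_intros cont_\<beta>)
  have "continuous_on (unit_cube n) (\<lambda>t. F t i)" for i
  proof (cases "i < n")
    case True
    then show ?thesis
      using continuous_on_compose2[OF cont[OF True] cont_\<sigma>] \<sigma>S by (auto simp: F_def)
  qed (simp add: F_def)
  then have "continuous_on (unit_cube n) F"
    by (rule continuous_on_coordinatewise_then_product)
  moreover have "F t \<in> unit_cube n" if t: "t \<in> unit_cube n" for t
  proof -
    have "\<phi> i (\<sigma> t) \<le> 1" if "i < n" for i
    proof -
      have "\<phi> i (\<sigma> t) \<le> (\<Sum>i<n. \<phi> i (\<sigma> t))"
        using that nonneg \<sigma>S[OF t] by (intro member_le_sum) auto
      then show ?thesis by (simp add: sum1[OF \<sigma>S[OF t]])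
    qed
    with nonneg \<sigma>S[OF t] show ?thesis by (simp add: unit_cube_def F_def)
  qed
  ultimately obtain t where t: "t \<in> unit_cube n" "F t = t"
    by (rule brouwer_unit_cube)
  have t_eq: "t i = \<phi> i (\<sigma> t)" if "i < n" for i
    using fun_cong[OF t(2), of i] that by (simp add: F_def)
  \<comment> \<open>At the fixed point the weights are already convex, so \<open>\<beta>\<close>
    leaves them alone and \<open>x0\<close> drops out.\<close>
  have "s t = 1" using sum1[OF \<sigma>S[OF t(1)]] by (simp add: s_def t_eq)
  then have "\<sigma> t = (\<Sum>i<n. t i *\<^sub>R w i)"
    by (simp add: \<sigma>_def \<beta>_def v_def lessThan_Suc_atMost[symmetric])
  also have "\<dots> = (\<Sum>i<n. \<phi> i (\<sigma> t) *\<^sub>R w i)"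
    by (intro sum.cong refl) (metis lessThan_iff t_eq)
  finally show ?thesis using \<sigma>S[OF t(1)] by blast
qed

text \<open>
  The point \<open>x\<close> does not depend on \<open>f\<close>: the Schauder projection moves \<open>g p\<close> only to averages of
  points \<open>g q\<close> with \<open>q\<close> close to \<open>p\<close>, so every functional is controlled by its own modulus of
  continuity.
\<close>

lemma approximate_fixed_point:
  fixes S :: "'a::real_normed_vector set" and g :: "'b::metric_space \<Rightarrow> 'a"
  assumes S: "convex S" "x0 \<in> S" and K: "compact K" and g: "g ` K \<subseteq> S"
    and h: "continuous_on S h" "h ` S \<subseteq> K" and \<epsilon>: "0 < \<epsilon>"
  shows "\<exists>x\<in>S. \<forall>f \<eta>. bounded_linear f \<longrightarrow>
    (\<forall>p\<in>K. \<forall>q\<in>K. dist p q < \<epsilon> \<longrightarrow> \<bar>f (g p) - f (g q) :: real\<bar> \<le> \<eta>) \<longrightarrow>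
    \<bar>f x - f (g (h x))\<bar> \<le> \<eta>"
proof -
  obtain Q where Q: "finite Q" "Q \<subseteq> K" "K \<subseteq> (\<Union>q\<in>Q. ball q \<epsilon>)"
    using seq_compact_imp_totally_bounded[OF compact_imp_seq_compact[OF K], rule_format, OF \<epsilon>]
    by (elim exE conjE) (rule that)
  obtain c where c: "bij_betw c {0..<card Q} Q"
    using ex_bij_betw_nat_finite[OF Q(1)] by blast
  define n where "n = card Q"
  have cQ: "c ` {..<n} = Q"
    using c by (auto simp: bij_betw_def n_def atLeast0LessThan)
  \<comment> \<open>Tent functions around the points of a finite \<open>\<epsilon>\<close>-net;
    divided by their sum they form a partition of unity on \<open>K\<close>.\<close>
  define \<mu> where "\<mu> i p = max 0 (\<epsilon> - dist p (c i))" for i p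
  define \<Lambda> where "\<Lambda> p = (\<Sum>i<n. \<mu> i p)" for p
  have cont_\<mu>: "continuous_on K (\<mu> i)" for i
    unfolding \<mu>_def by (intro continuous_intros)
  have cont_\<Lambda>: "continuous_on K \<Lambda>"
    unfolding \<Lambda>_def by (intro continuous_intros cont_\<mu>)
  have pos: "0 < \<Lambda> p" if p: "p \<in> K" for p
  proof -
    obtain q where "q \<in> Q" "dist q p < \<epsilon>" using subsetD[OF Q(3) p] by auto
    then obtain i where i: "i < n" "dist (c i) p < \<epsilon>" unfolding cQ[symmetric] by auto
    then have "0 < \<mu> i p" by (simp add: \<mu>_def dist_commute)
    then show ?thesis
      unfolding \<Lambda>_def using i(1) by (intro sum_pos2[where i = i]) (simp_all add: \<mu>_def)
  qed
  define \<phi> where "\<phi> i x = \<mu> i (h x) / \<Lambda> (h x)" for i x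
  have cK: "c i \<in> K" if "i < n" for i
    using that cQ Q(2) by auto
  have hK: "h x \<in> K" if "x \<in> S" for x
    using that h(2) by auto
  have "\<exists>x\<in>S. x = (\<Sum>i<n. \<phi> i x *\<^sub>R g (c i))"
  proof (rule finite_rank_fixed_point[OF S])
    show "g (c i) \<in> S" if "i < n" for i using cK[OF that] g by auto
    show "0 \<le> \<phi> i x" if "x \<in> S" for i x
      using less_imp_le[OF pos[OF hK[OF that]]] by (simp add: \<phi>_def \<mu>_def)
    show "(\<Sum>i<n. \<phi> i x) = 1" if "x \<in> S" for x
      using pos[OF hK[OF that]] by (simp add: \<phi>_def sum_divide_distrib[symmetric] \<Lambda>_def[symmetric])
    show "continuous_on S (\<phi> i)" for i
      unfolding \<phi>_def
    proof (rule continuous_on_divide)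
      show "continuous_on S (\<lambda>x. \<mu> i (h x))" by (rule continuous_on_compose2[OF cont_\<mu> h])
      show "continuous_on S (\<lambda>x. \<Lambda> (h x))" by (rule continuous_on_compose2[OF cont_\<Lambda> h])
      show "\<forall>x\<in>S. \<Lambda> (h x) \<noteq> 0" by (metis hK less_irrefl pos)
    qed
  qed
  then obtain x where x: "x \<in> S" "x = (\<Sum>i<n. \<phi> i x *\<^sub>R g (c i))"
    by (elim bexE) (rule that)
  have bound: "\<bar>f x - f (g (h x))\<bar> \<le> \<eta>"
    if f: "bounded_linear f"
      and \<eta>: "\<forall>p\<in>K. \<forall>q\<in>K. dist p q < \<epsilon> \<longrightarrow> \<bar>f (g p) - f (g q)\<bar> \<le> \<eta>"
    for f :: "'a \<Rightarrow> real" and \<eta>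
  proof -
    have nonneg: "0 \<le> \<phi> i x" for i
      using less_imp_le[OF pos[OF hK[OF x(1)]]] by (simp add: \<phi>_def \<mu>_def)
    have sum1: "(\<Sum>i<n. \<phi> i x) = 1"
      using pos[OF hK[OF x(1)]] by (simp add: \<phi>_def sum_divide_distrib[symmetric] \<Lambda>_def[symmetric])
    have "f x = f (\<Sum>i<n. \<phi> i x *\<^sub>R g (c i))" by (rule arg_cong[OF x(2)])
    also have "\<dots> = (\<Sum>i<n. \<phi> i x * f (g (c i)))"
      using bounded_linear.linear[OF f] by (simp add: linear_sum linear_scale)
    \<comment> \<open>Because the weights sum to 1, the error becomes a weighted average of
      differences of \<open>f\<close> at points of the net and at \<open>h x\<close>.\<close>
    finally have "f x - f (g (h x)) =
        (\<Sum>i<n. \<phi> i x * f (g (c i))) - (\<Sum>i<n. \<phi> i x) * f (g (h x))"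
      by (simp only: sum1 mult_1)
    also have "\<dots> = (\<Sum>i<n. \<phi> i x * (f (g (c i)) - f (g (h x))))"
      by (simp only: right_diff_distrib sum_subtractf sum_distrib_right)
    finally have "\<bar>f x - f (g (h x))\<bar> = \<bar>\<Sum>i<n. \<phi> i x * (f (g (c i)) - f (g (h x)))\<bar>"
      by simp
    also have "\<dots> \<le> (\<Sum>i<n. \<bar>\<phi> i x * (f (g (c i)) - f (g (h x)))\<bar>)"
      by (rule sum_abs)
    also have "\<dots> \<le> (\<Sum>i<n. \<phi> i x * \<eta>)"
    proof (rule sum_mono)
      fix i
      assume "i \<in> {..<n}"
      then have "c i \<in> K" using cK by simp
      show "\<bar>\<phi> i x * (f (g (c i)) - f (g (h x)))\<bar> \<le> \<phi> i x * \<eta>"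
      \<comment> \<open>A nonzero weight means that \<open>c i\<close> is within
        \<open>\<epsilon>\<close> of \<open>h x\<close>.\<close>
      proof (cases "\<phi> i x = 0")
        case False
        then have "\<mu> i (h x) \<noteq> 0" by (simp add: \<phi>_def)
        then have "dist (c i) (h x) < \<epsilon>"
          unfolding \<mu>_def by (simp add: dist_commute)
        then have "\<bar>f (g (c i)) - f (g (h x))\<bar> \<le> \<eta>"
          using \<eta> \<open>c i \<in> K\<close> hK[OF x(1)] by simp
        then show ?thesis
          unfolding abs_mult abs_of_nonneg[OF nonneg] by (rule mult_left_mono[OF _ nonneg])
      qed simp
    qed
    also have "\<dots> = \<eta>" by (simp only: sum_distrib_right[symmetric] sum1 mult_1)
    finally show ?thesis .
  qed
  show ?thesis by (intro bexI[OF _ x(1)] allI impI) (rule bound)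
qed

text \<open>On the compact set \<open>K\<close> the composite of \<open>f\<close> and
  \<open>g\<close> is uniformly continuous, so any error bound becomes admissible in
  \<open>approx\<close> once \<open>m\<close> is large.\<close>

lemma uniformly_continuous_functional_tendsto:
  fixes g :: "'b::metric_space \<Rightarrow> 'a::real_normed_vector" and f :: "'a \<Rightarrow> real"
  assumes K: "compact K" and cont: "continuous_on K (\<lambda>p. f (g p))" and r: "strict_mono r"
    and approx: "\<And>m \<eta>. (\<forall>p\<in>K. \<forall>q\<in>K. dist p q < inverse (real (Suc m)) \<longrightarrow> \<bar>f (g p) - f (g q)\<bar> \<le> \<eta>)
      \<Longrightarrow> \<bar>f (x m) - f (y m)\<bar> \<le> \<eta>"
  shows "(\<lambda>k. f (x (r k)) - f (y (r k))) \<longlonglongrightarrow> 0"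
proof (rule LIMSEQ_I)
  fix \<eta> :: real
  assume "0 < \<eta>"
  then have "0 < \<eta> / 2" by simp
  then obtain \<delta> where \<delta>: "0 < \<delta>"
    "\<forall>p\<in>K. \<forall>q\<in>K. dist q p < \<delta> \<longrightarrow> dist (f (g q)) (f (g p)) < \<eta> / 2"
    using compact_uniformly_continuous[OF cont K] unfolding uniformly_continuous_on_def by blast
  obtain N where N: "inverse (real (Suc N)) < \<delta>" using reals_Archimedean[OF \<delta>(1)] by blast
  show "\<exists>N. \<forall>k\<ge>N. norm (f (x (r k)) - f (y (r k)) - 0) < \<eta>"
  proof (intro exI[of _ N] allI impI)
    fix k
    assume "N \<le> k"
    then have "N \<le> r k" using seq_suble[OF r, of k] by linarith
    then have "inverse (real (Suc (r k))) \<le> inverse (real (Suc N))" by simp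
    with N have small: "inverse (real (Suc (r k))) < \<delta>" by linarith
    have "\<bar>f (x (r k)) - f (y (r k))\<bar> \<le> \<eta> / 2"
    proof (rule approx, intro ballI impI)
      fix p q
      assume pq: "p \<in> K" "q \<in> K" "dist p q < inverse (real (Suc (r k)))"
      then have "dist p q < \<delta>" using small by linarith
      with \<delta>(2) pq(1,2) have "dist (f (g p)) (f (g q)) < \<eta> / 2" by blast
      then show "\<bar>f (g p) - f (g q)\<bar> \<le> \<eta> / 2" by (simp add: dist_real_def)
    qed
    with \<open>0 < \<eta>\<close> show "norm (f (x (r k)) - f (y (r k)) - 0) < \<eta>" by simp
  qed
qed

theorem weakly_seq_continuous_fixed_point:
  fixes S :: "'a::real_normed_vector set"
  assumes S: "S \<noteq> {}" "closed S" "convex S" and TS: "T ` S \<subseteq> S"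
    and T: "weakly_seq_continuous_on S T" and rwc: "relatively_weakly_compact (T ` S)"
  shows "\<exists>x\<in>S. T x = x"
proof -
  obtain x0 where "x0 \<in> S" using S(1) by blast
  then have "countable {x0}" "{x0} \<subseteq> S" by simp_all
  then obtain D where D: "countable D" "D \<subseteq> S" "{x0} \<subseteq> D" "T ` D \<subseteq> D" "convex (closure D)"
    by (metis countable_invariant_superset[OF _ _ S(3) TS])
  let ?S = "closure D"
  have subS: "?S \<subseteq> S" using D(2) S(2) by (rule closure_minimal)
  have x0: "x0 \<in> ?S" using D(3) closure_subset by blast
  have weak_cont: "weakly_converges (\<lambda>k. T (u k)) (T x)"
    if "\<And>k. u k \<in> ?S" "x \<in> ?S" "weakly_converges u x" for u x
    using T subS that unfolding weakly_seq_continuous_on_def by blast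
  \<comment> \<open>Norm continuity of \<open>T\<close> is not at hand: the image of a limit is only
    a weak limit of points of \<open>D\<close>, but the closed convex closure is also weakly
    closed.\<close>
  have TclD: "T x \<in> ?S" if x: "x \<in> ?S" for x
  proof -
    obtain u where u: "\<And>k. u k \<in> D" "u \<longlonglongrightarrow> x"
      using x unfolding closure_sequential by blast
    have "u k \<in> ?S" for k using u(1) closure_subset by blast
    then have "weakly_converges (\<lambda>k. T (u k)) (T x)"
      by (rule weak_cont[OF _ x tendsto_imp_weakly_converges[OF u(2)]])
    moreover have "T (u k) \<in> ?S" for k using u(1) D(4) closure_subset[of D] by blast
    ultimately show ?thesis
      by (rule weakly_converges_in_closed_convex[OF closed_closure D(5)])
  qed
  \<comment> \<open>Intersecting with the closure of \<open>D\<close> provides the separability on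
    which the embedding depends.\<close>
  define W where "W = ?S \<inter> (weak_topology closure_of (T ` S))"
  have W: "compactin weak_topology W"
    unfolding W_def using rwc D(5)
    by (intro closed_Int_compactin closedin_weak_topology_closed_convex)
      (simp_all add: relatively_weakly_compact_def)
  have TW: "T x \<in> W" if x: "x \<in> ?S" for x
  proof -
    have "T x \<in> T ` S" using x subS by blast
    then have "T x \<in> weak_topology closure_of (T ` S)"
      using closure_of_subset[of "T ` S" weak_topology] by auto
    then show ?thesis using TclD[OF x] by (simp add: W_def)
  qed
  have WS: "W \<subseteq> ?S" by (simp add: W_def)
  show ?thesis
  proof (rule weakly_compact_embedding[OF W D(1) WS])
    fix G :: "'a \<Rightarrow> nat \<Rightarrow> real" and g
    assume G: "\<And>u x. weakly_converges u x \<Longrightarrow> (\<lambda>k. G (u k)) \<longlonglongrightarrow> G x"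
      and gG: "\<And>x. x \<in> W \<Longrightarrow> g (G x) = x"
      and K: "compact (G ` W)"
      and g: "\<And>f :: 'a \<Rightarrow> real. bounded_linear f \<Longrightarrow> continuous_on (G ` W) (\<lambda>p. f (g p))"
    have gS: "g ` G ` W \<subseteq> ?S" using gG WS by auto
    have h: "(\<lambda>x. G (T x)) ` ?S \<subseteq> G ` W" using TW by auto
    \<comment> \<open>Norm convergence is weakened, preserved by \<open>T\<close>, and turned by
      \<open>G\<close> into convergence in a metric space.\<close>
    have "continuous_on ?S (\<lambda>x. G (T x))"
      unfolding continuous_on_sequentially
    proof (intro allI ballI impI, elim conjE)
      fix u a
      assume "\<forall>k. u k \<in> ?S" "a \<in> ?S" "u \<longlonglongrightarrow> a"
      then have "weakly_converges (\<lambda>k. T (u k)) (T a)"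
        by (intro weak_cont tendsto_imp_weakly_converges) blast+
      from G[OF this] show "((\<lambda>x. G (T x)) \<circ> u) \<longlonglongrightarrow> G (T a)" by (simp add: o_def)
    qed
    note approx = approximate_fixed_point[OF D(5) x0 K gS this h]
    have "\<exists>x\<in>?S. \<forall>f \<eta>. bounded_linear f \<longrightarrow>
      (\<forall>p\<in>G ` W. \<forall>q\<in>G ` W. dist p q < inverse (real (Suc m)) \<longrightarrow> \<bar>f (g p) - f (g q) :: real\<bar> \<le> \<eta>) \<longrightarrow>
      \<bar>f x - f (g (G (T x)))\<bar> \<le> \<eta>" for m
      by (rule approx) simp
    then obtain x where x: "\<And>m. x m \<in> ?S"
      and near: "\<And>m f \<eta>. bounded_linear f \<Longrightarrow>
        (\<forall>p\<in>G ` W. \<forall>q\<in>G ` W. dist p q < inverse (real (Suc m)) \<longrightarrow> \<bar>f (g p) - f (g q) :: real\<bar> \<le> \<eta>) \<Longrightarrow>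
        \<bar>f (x m) - f (g (G (T (x m))))\<bar> \<le> \<eta>"
      by metis
    \<comment> \<open>Compactness applies to the images \<open>T (x k)\<close>; the points
      \<open>x k\<close> then follow, because their differences from the images are weakly
      null.\<close>
    obtain r w where r: "strict_mono r" and w: "w \<in> W"
      and lim: "weakly_converges (\<lambda>k. T (x (r k))) w"
      using weakly_compact_imp_convergent_subseq[OF W, of "\<lambda>k. T (x k)"] TW[OF x] by metis
    have "(\<lambda>k. f (x (r k))) \<longlonglongrightarrow> f w" if f: "bounded_linear f" for f :: "'a \<Rightarrow> real"
    proof -
      have "(\<lambda>k. f (x (r k)) - f (T (x (r k)))) \<longlonglongrightarrow> 0"
      proof (rule uniformly_continuous_functional_tendsto[where f = f and g = g, OF K g[OF f] r])
        show "\<bar>f (x m) - f (T (x m))\<bar> \<le> \<eta>"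
          if "\<forall>p\<in>G ` W. \<forall>q\<in>G ` W. dist p q < inverse (real (Suc m)) \<longrightarrow> \<bar>f (g p) - f (g q)\<bar> \<le> \<eta>" for m \<eta>
          using near[OF f that] unfolding gG[OF TW[OF x]] .
      qed
      moreover have "(\<lambda>k. f (T (x (r k)))) \<longlonglongrightarrow> f w"
        using lim f unfolding weakly_converges_iff by blast
      ultimately have "(\<lambda>k. (f (x (r k)) - f (T (x (r k)))) + f (T (x (r k)))) \<longlonglongrightarrow> 0 + f w"
        by (rule tendsto_add)
      then show ?thesis by simp
    qed
    then have "weakly_converges (\<lambda>k. x (r k)) w" unfolding weakly_converges_iff by blast
    then have "weakly_converges (\<lambda>k. T (x (r k))) (T w)"
      using x w WS by (intro weak_cont) blast+
    then have "T w = w" using lim by (rule weakly_converges_unique)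
    moreover have "w \<in> S" using w WS subS by blast
    ultimately show ?thesis by (rule bexI)
  qed
qed

section \<open>The operator equation\<close>

text \<open>Multiplying by the inverse of \<open>A x\<close> solves \<open>A x * v = x - C x\<close>
  uniquely, so the description denotes that solution.\<close>

lemma quotient_operator_eq_iff:
  assumes e: "is_unit_element e" and A: "regular_operator e A"
  shows "quotient_operator A C x = z \<longleftrightarrow> x = A x * z + C x"
proof -
  have "A x \<in> invertible_elements e" using A by (auto simp: regular_operator_def)
  then obtain y where y: "A x * y = e" "y * A x = e" by (auto simp: invertible_elements_def)
  have e1: "e * v = v" for v using e by (simp add: is_unit_element_def)
  have solve: "A x * v = x - C x \<longleftrightarrow> v = y * (x - C x)" for v
  proof
    assume v: "A x * v = x - C x"
    have "y * (x - C x) = e * v" unfolding v[symmetric] mult.assoc[symmetric] y(2) ..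
    then show "v = y * (x - C x)" unfolding e1 by (rule sym)
  next
    assume v: "v = y * (x - C x)"
    have "A x * v = e * (x - C x)" unfolding v mult.assoc[symmetric] y(1) ..
    then show "A x * v = x - C x" unfolding e1 .
  qed
  have "quotient_operator A C x = y * (x - C x)"
    unfolding quotient_operator_def solve by (rule the_eq_trivial)
  then have "quotient_operator A C x = z \<longleftrightarrow> A x * z = x - C x"
    unfolding solve by (simp only: eq_commute)
  also have "\<dots> \<longleftrightarrow> x = A x * z + C x" unfolding eq_diff_eq by (rule eq_commute)
  finally show ?thesis .
qed

lemma inverse_operator_eq_iff:
  assumes "z \<in> inverse_domain Q"
  shows "inverse_operator Q z = x \<longleftrightarrow> Q x = z"
proof -
  have ex1: "\<exists>!x. Q x = z" using assms by (simp add: inverse_domain_def)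
  then have "Q (inverse_operator Q z) = z" unfolding inverse_operator_def by (rule theI')
  with ex1 show ?thesis by blast
qed

text \<open>If convergence failed for one functional, some subsequence would keep its values at
  least \<open>\<epsilon>\<close> away from \<open>f x\<close>, and so would each further
  subsequence.\<close>

lemma weakly_converges_if_subseq:
  fixes u :: "nat \<Rightarrow> 'a::real_normed_vector"
  assumes "\<And>r :: nat \<Rightarrow> nat. strict_mono r \<Longrightarrow> \<exists>r' :: nat \<Rightarrow> nat. strict_mono r' \<and> weakly_converges (\<lambda>k. u (r (r' k))) x"
  shows "weakly_converges u x"
  unfolding weakly_converges_iff
proof (intro allI impI, rule ccontr)
  fix f :: "'a \<Rightarrow> real"
  assume f: "bounded_linear f" and "\<not> (\<lambda>k. f (u k)) \<longlonglongrightarrow> f x"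
  then obtain \<epsilon> where \<epsilon>: "0 < \<epsilon>" "\<exists>\<^sub>F k in sequentially. \<epsilon> \<le> dist (f (u k)) (f x)"
    by (auto simp: tendsto_iff not_eventually not_less)
  then have "infinite {k. \<epsilon> \<le> dist (f (u k)) (f x)}"
    unfolding cofinite_eq_sequentially[symmetric] frequently_cofinite by blast
  then obtain r :: "nat \<Rightarrow> nat" where r: "strict_mono r" "\<And>k. \<epsilon> \<le> dist (f (u (r k))) (f x)"
    using infinite_enumerate by blast
  obtain r' where "weakly_converges (\<lambda>k. u (r (r' k))) x"
    using assms[OF r(1)] by blast
  then have "(\<lambda>k. f (u (r (r' k)))) \<longlonglongrightarrow> f x"
    using f unfolding weakly_converges_iff by blast
  then have "\<forall>\<^sub>F k in sequentially. dist (f (u (r (r' k)))) (f x) < \<epsilon>"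
    using \<epsilon>(1) by (rule tendstoD)
  moreover have "\<not> dist (f (u (r (r' k)))) (f x) < \<epsilon>" for k
    using r(2)[of "r' k"] by linarith
  ultimately show False by simp
qed

theorem theorem3p1:
  fixes n :: nat
    and vn :: "'a::{real_normed_algebra, banach} \<Rightarrow> real Matrix.vec"
    and e :: 'a
    and S :: "'a set"
    and A B C :: "'a \<Rightarrow> 'a"
    and M_A M_C :: "real mat"
  assumes X: "generalized_banach_algebra n vn"
    and e: "is_unit_element e"
    and GP: "condition_GP TYPE('a)"
    and S: "S \<noteq> {}" "closed S" "convex S"
    and A_wsc: "weakly_seq_continuous_on UNIV A"
    and C_wsc: "weakly_seq_continuous_on UNIV C"
    and B_wsc: "weakly_seq_continuous_on S B"
    and i: "contractive_with n vn M_A A" "contractive_with n vn M_C C"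
    and ii: "regular_operator e A"
    and iii: "bounded (B ` S)"
    and iv: "\<And>x y. y \<in> S \<Longrightarrow> x = A x * B y + C x \<Longrightarrow> x \<in> S"
    and v: "B ` S \<subseteq> inverse_domain (quotient_operator A C)"
           "weakly_compact_on (inverse_domain (quotient_operator A C))
              (inverse_operator (quotient_operator A C))"
    and M: "nonneg_matrix n (scale_add_matrix n (sup_vnorm n vn (B ` S)) M_A M_C)"
           "converges_to_zero (scale_add_matrix n (sup_vnorm n vn (B ` S)) M_A M_C)"
  shows "\<exists>x\<in>S. x = A x * B x + C x"
proof -
  define T where "T y = inverse_operator (quotient_operator A C) (B y)" for y
  \<comment> \<open>Membership of \<open>B y\<close> in \<open>inverse_domain\<close> gives exactly
    one solution \<open>x\<close>: existence yields the equation for \<open>T y\<close>, and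
    uniqueness later identifies weak limits.\<close>
  have T_iff: "T y = x \<longleftrightarrow> x = A x * B y + C x" if "y \<in> S" for x y
  proof -
    have "T y = x \<longleftrightarrow> quotient_operator A C x = B y"
      unfolding T_def using v(1) that by (intro inverse_operator_eq_iff) blast
    also have "\<dots> \<longleftrightarrow> x = A x * B y + C x" by (rule quotient_operator_eq_iff[OF e ii])
    finally show ?thesis .
  qed
  have T_eq: "T y = A (T y) * B y + C (T y)" if "y \<in> S" for y
    by (rule T_iff[OF that, THEN iffD1, OF refl])
  have TS: "T ` S \<subseteq> S"
  proof (rule image_subsetI)
    fix y
    assume "y \<in> S"
    then show "T y \<in> S" by (intro iv[OF _ T_eq])
  qed
  have rwc: "relatively_weakly_compact (T ` S)"
  proof -
    have "T ` S = inverse_operator (quotient_operator A C) ` (B ` S)"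
      by (simp add: T_def image_image)
    moreover have "relatively_weakly_compact (inverse_operator (quotient_operator A C) ` (B ` S))"
      using v(2)[unfolded weakly_compact_on_def] v(1) iii by blast
    ultimately show ?thesis by (simp only:)
  qed
  have "weakly_seq_continuous_on S T"
    unfolding weakly_seq_continuous_on_def
  proof (intro allI impI)
    fix u x
    assume u: "\<forall>k. u k \<in> S" and x: "x \<in> S" and lim: "weakly_converges u x"
    show "weakly_converges (\<lambda>k. T (u k)) (T x)"
    proof (rule weakly_converges_if_subseq)
      fix r :: "nat \<Rightarrow> nat"
      assume r: "strict_mono r"
      have "T ` S \<subseteq> weak_topology closure_of (T ` S)" by (rule closure_of_subset) simp
      then have "T (u (r k)) \<in> weak_topology closure_of (T ` S)" for k using u by blast
      then obtain r' w where r': "strict_mono r'" and w: "weakly_converges (\<lambda>k. T (u (r (r' k)))) w"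
        using weakly_compact_imp_convergent_subseq[OF rwc[unfolded relatively_weakly_compact_def],
            of "\<lambda>k. T (u (r k))"] by metis
      let ?u = "\<lambda>k. u (r (r' k))"
      have "weakly_converges ?u x"
        using weakly_converges_subseq[OF weakly_converges_subseq[OF lim r] r'] .
      then have B: "weakly_converges (\<lambda>k. B (?u k)) (B x)"
        by (rule weakly_seq_continuous_onD[OF B_wsc _ u[rule_format] x])
      have A: "weakly_converges (\<lambda>k. A (T (?u k))) (A w)"
        by (rule weakly_seq_continuous_onD[OF A_wsc w UNIV_I UNIV_I])
      have C: "weakly_converges (\<lambda>k. C (T (?u k))) (C w)"
        by (rule weakly_seq_continuous_onD[OF C_wsc w UNIV_I UNIV_I])
      \<comment> \<open>Both factors converge only weakly; \<open>condition_GP\<close> is what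
        allows the product to pass to the limit.\<close>
      have "weakly_converges (\<lambda>k. A (T (?u k)) * B (?u k) + C (T (?u k))) (A w * B x + C w)"
        by (rule weakly_converges_add[OF weakly_converges_mult[OF GP A B] C])
      moreover have "A (T (?u k)) * B (?u k) + C (T (?u k)) = T (?u k)" for k
        by (rule T_eq[symmetric]) (rule u[rule_format])
      ultimately have "weakly_converges (\<lambda>k. T (?u k)) (A w * B x + C w)" by (simp only:)
      \<comment> \<open>The limit solves the equation for \<open>x\<close>, so it is
        \<open>T x\<close> whatever the subsequence was.\<close>
      then have "w = A w * B x + C w" by (rule weakly_converges_unique[OF w])
      then have "T x = w" by (rule T_iff[OF x, THEN iffD2])
      with r' w show "\<exists>r'. strict_mono r' \<and> weakly_converges (\<lambda>k. T (u (r (r' k)))) (T x)"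
        by blast
    qed
  qed
  from weakly_seq_continuous_fixed_point[OF S TS this rwc]
  obtain x where "x \<in> S" "T x = x" by (elim bexE) (rule that)
  then show ?thesis by (intro bexI[of _ x] T_iff[THEN iffD1])
qed

end
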